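(* Let $r(x)=\sum_{n\ge 0}x^{2^n-1}=1+x+x^3+x^7+\cdots$. Then for every $n\ge 0$, $$H_n\!\left(\frac{r(x)}{r(x)-x}\right)=\operatorname{sign}\big(H_n(1-xr(x))\big).$$
   Context: For a power series $f(x)=\sum_{i\ge 0}a_ix^i$ and $n\ge 1$, $H_n(f)=\det(a_{i+j})_{0\le i,j\le n-1}$, $H_0(f)=1$. $\operatorname{sign}(y)=+1$ if $y\ge 0$ and $-1$ if $y<0$. *)

theory Defs
  imports
    "HOL-Computational_Algebra.Formal_Power_Series"
    "Jordan_Normal_Form.Determinant"
begin

(* For n = 0 this is the determinant of the empty matrix, which is 1. *)
definition hankel_det :: "nat \<Rightarrow> 'a::comm_ring_1 fps \<Rightarrow> 'a" where
  "hankel_det n f = det (mat n n (\<lambda>(i, j). fps_nth f (i + j)))"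

lemma hankel_det_0: "hankel_det 0 f = 1"
  by (simp add: hankel_det_def)

(* Unlike sgn, this takes the value 1 at 0. *)
definition sign_nonneg :: "rat \<Rightarrow> rat" where
  "sign_nonneg y = (if y \<ge> 0 then 1 else - 1)"

(* The exponents 2 ^ k - 1 are pairwise distinct, so every coefficient is 0 or 1. *)
definition r_series :: "rat fps" where
  "r_series = Abs_fps (\<lambda>m. if \<exists>k::nat. m = 2 ^ k - 1 then 1 else 0)"

lemma r_series_sums: "(\<lambda>k::nat. fps_X ^ (2 ^ k - 1)) sums r_series"
  unfolding sums_def
proof (rule tendsto_fpsI)
  fix m :: nat
  have inj: "k = l" if "m = 2 ^ k - 1" "m = 2 ^ l - 1" for k l :: nat
  proof -
    have "(2::nat) ^ k = Suc m" "(2::nat) ^ l = Suc m"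
      using that by (metis Suc_diff_1 zero_less_numeral zero_less_power)+
    then have "(2::nat) ^ k = 2 ^ l"
      by simp
    then show ?thesis
      by simp
  qed
  have "fps_nth (\<Sum>k<N. fps_X ^ (2 ^ k - 1)) m = fps_nth r_series m" if "N > m" for N
  proof (cases "\<exists>k::nat. m = 2 ^ k - 1")
    case True
    then obtain k :: nat where k: "m = 2 ^ k - 1" by blast
    have "k < 2 ^ k" by simp
    with k that have "k < N" by linarith
    have "(m = 2 ^ l - 1) = (l = k)" for l :: nat
      using k inj[of l k] by blast
    then show ?thesis
      using True \<open>k < N\<close> by (simp add: fps_sum_nth r_series_def fps_X_power_nth)
  next
    case False
    then show ?thesis
      by (auto simp add: fps_sum_nth r_series_def fps_X_power_nth)
  qed
  then show "\<forall>\<^sub>F N in sequentially. fps_nth (\<Sum>k<N. fps_X ^ (2 ^ k - 1)) m = fps_nth r_series m"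
    by (rule eventually_mono[OF eventually_gt_at_top[of m]])
qed

end

theory Submission
  imports Defs
begin

text \<open>Let \<open>s m = 1\<close> if \<open>m\<close> is a power of two and \<open>s m = 0\<close> otherwise, so that \<open>x r(x)\<close> has coefficients
  \<open>s\<close>, and let \<open>M = (s (i + j))\<close> with \<open>1 \<le> i, j \<le> N\<close>, where \<open>n = N + 1\<close>. Multiplying the Hankel
  matrix of \<open>r / (r - x)\<close> on both sides by the unitriangular Toeplitz matrix of \<open>r - x\<close> gives the
  matrix \<open>r\<^sub>i r\<^sub>j - [i, j \<ge> 1] s (i + j)\<close>, whose determinant is \<open>det (-M)\<close>. If \<open>M w = v\<close> with
  \<open>v = (s 1, \<dots>, s N)\<close>, then a column operation shows that the Hankel determinant of \<open>1 - x r(x)\<close> is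
  \<open>(1 + v \<bullet> w) det (-M)\<close>. It remains to see that \<open>M\<close> is invertible over the integers, so that its
  determinant is \<open>1\<close> or \<open>-1\<close>, and that \<open>v \<bullet> w \<ge> 0\<close>. For \<open>K = 2\<^sup>k \<le> N < 2 K\<close>, every row \<open>i \<ge> K\<close> of
  \<open>M\<close> has its only nonzero entry in column \<open>2 K - i\<close>; eliminating these rows and columns reduces
  \<open>N\<close> to \<open>2 K - N - 1\<close> and lowers \<open>v \<bullet> w\<close> by \<open>1\<close>.\<close>

section \<open>The integral Hankel system of the powers of two\<close>

definition pow2_ind :: "nat \<Rightarrow> int" where
  "pow2_ind m = (if \<exists>k::nat. m = 2 ^ k then 1 else 0)"

lemma pow2_ind_nonneg: "pow2_ind m \<ge> 0"
  by (simp add: pow2_ind_def)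

lemma pow2_ind_between:
  assumes "2 ^ k < m" "m < 4 * 2 ^ k"
  shows "pow2_ind m = (if m = 2 * 2 ^ k then 1 else 0)"
proof -
  have "m = 2 * 2 ^ k" if m: "m = 2 ^ l" for l
  proof -
    have "(2::nat) ^ l < 2 ^ (k + 2)"
      using assms m by (simp add: power_add)
    then have "k < l" "l < k + 2"
      using assms(1) unfolding m by (simp_all only: power_strict_increasing_iff[of "2::nat"])
    then have "l = Suc k"
      by simp
    then show ?thesis
      using m by simp
  qed
  moreover have "\<exists>l::nat. 2 * 2 ^ k = (2 ^ l :: nat)"
    by (rule exI[of _ "Suc k"]) simp
  ultimately show ?thesis
    unfolding pow2_ind_def by auto
qed

text \<open>Arbitrary \<open>y\<close> lets the recursion change the right-hand side, and unit
  vectors then yield an integral inverse. The sign claim is carried along because it concerns the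
  particular solution being built.\<close>

lemma pow2_hankel_solvable:
  fixes y :: "nat \<Rightarrow> int"
  shows "\<exists>x. (\<forall>i\<in>{1..N}. (\<Sum>j=1..N. pow2_ind (i + j) * x j) = y i) \<and>
             ((\<forall>i\<in>{1..N}. y i = pow2_ind i) \<longrightarrow> (\<Sum>j=1..N. pow2_ind j * x j) \<ge> 0)"
proof (induction N arbitrary: y rule: less_induct)
  case (less N)
  show ?case
  proof (cases "N = 0")
    case True
    then show ?thesis by simp
  next
    case False
    obtain k where k: "2 ^ k \<le> N" "N < 2 ^ (k + 1)"
      using ex_power_ivl1[of 2 N] False by auto
    define K where "K = (2::nat) ^ k"
    have K: "K \<le> N" "N < 2 * K" "K > 0"
      using k by (auto simp: K_def)
    \<comment> \<open>Rows \<open>i\<close> up to \<open>N'\<close> vanish in all columns beyond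
      \<open>K\<close>, since there \<open>K < i + j < 2 * K\<close>.\<close>
    define N' where "N' = 2 * K - N - 1"
    have N': "N' < K" "N' < N" "N' + N + 1 = 2 * K"
      using K by (auto simp: N'_def)
    have ind: "pow2_ind m = (if m = 2 * K then 1 else 0)" if "K < m" "m < 4 * K" for m
      using pow2_ind_between[of k m] that by (simp add: K_def)
    have split: "(\<Sum>j=1..N. g j) = (\<Sum>j=1..N'. g j) + (\<Sum>j=N'+1..K. g j) + (\<Sum>j=K+1..N. g j)"
      for g :: "nat \<Rightarrow> int"
    proof -
      have "{1..N} = ({1..N'} \<union> {N'+1..K}) \<union> {K+1..N}"
        using N' K by auto
      then have "(\<Sum>j=1..N. g j) = sum g (({1..N'} \<union> {N'+1..K}) \<union> {K+1..N})"
        by simp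
      also have "\<dots> = sum g {1..N'} + sum g {N'+1..K} + sum g {K+1..N}"
        using N' by (subst sum.union_disjoint; (subst sum.union_disjoint)?) auto
      finally show ?thesis .
    qed
    \<comment> \<open>For \<open>j\<close> from \<open>N'+1\<close> to \<open>K\<close>, row
      \<open>2 * K - j\<close> forces \<open>x j = y (2 * K - j)\<close>; these known terms move to
      the right-hand side.\<close>
    define y' where "y' i = y i - (\<Sum>j=N'+1..K. pow2_ind (i + j) * y (2 * K - j))" for i
    obtain x' where x': "\<And>i. i \<in> {1..N'} \<Longrightarrow> (\<Sum>j=1..N'. pow2_ind (i + j) * x' j) = y' i"
      and q': "(\<forall>i\<in>{1..N'}. y' i = pow2_ind i) \<Longrightarrow> (\<Sum>j=1..N'. pow2_ind j * x' j) \<ge> 0"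
      using less.IH[OF N'(2), of y'] by blast
    define z where "z j = (if j \<le> N' then x' j else y (2 * K - j))" for j
    \<comment> \<open>For \<open>K < j\<close> the value is read off from row
      \<open>2 * K - j\<close>, where \<open>x j\<close> has coefficient 1 and all other nonzero
      entries lie in columns up to \<open>K\<close>.\<close>
    define x where "x j = (if j \<le> K then z j
        else z j - (\<Sum>l=1..N'. pow2_ind (2 * K - j + l) * z l)
                 - (\<Sum>l=N'+1..K. pow2_ind (2 * K - j + l) * z l))" for j
    have xA: "(\<Sum>j=1..N'. g j * x j) = (\<Sum>j=1..N'. g j * x' j)" for g
      using N' by (intro sum.cong) (auto simp: x_def z_def)
    have xB: "(\<Sum>j=N'+1..K. g j * x j) = (\<Sum>j=N'+1..K. g j * y (2 * K - j))" for g
      using N' by (intro sum.cong) (auto simp: x_def z_def)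
    have single: "(\<Sum>j\<in>S. pow2_ind (i + j) * x j) = (if 2 * K - i \<in> S then x (2 * K - i) else 0)"
      if "finite S" "i \<le> 2 * K" "\<And>j. j \<in> S \<Longrightarrow> K < i + j \<and> i + j < 4 * K" for S i
    proof -
      have "(\<Sum>j\<in>S. pow2_ind (i + j) * x j) = (\<Sum>j\<in>S. if j = 2 * K - i then x j else 0)"
        using that by (intro sum.cong) (auto simp: ind)
      then show ?thesis
        using that(1) by simp
    qed
    have rows: "(\<Sum>j=1..N. pow2_ind (i + j) * x j) = y i" if i: "i \<in> {1..N}" for i
    proof -
      consider "i \<le> N'" | "N' < i" "i < K" | "K \<le> i"
        by linarith
      then show ?thesis
      proof cases
        case 1
        have "(\<Sum>j=K+1..N. pow2_ind (i + j) * x j) = 0"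
          using 1 N' K by (subst single) auto
        then show ?thesis
          using 1 i unfolding split xA xB by (subst x') (auto simp: y'_def)
      next
        case 2
        have "(\<Sum>j=K+1..N. pow2_ind (i + j) * x j) = x (2 * K - i)"
          using 2 N' K by (subst single) auto
        moreover have "2 * K - i > K" "2 * K - (2 * K - i) = i"
          using 2 by auto
        then have "x (2 * K - i) = y i - (\<Sum>l=1..N'. pow2_ind (i + l) * z l)
                 - (\<Sum>l=N'+1..K. pow2_ind (i + l) * z l)"
          using 2 N' K by (simp add: x_def z_def)
        moreover have "(\<Sum>l=1..N'. pow2_ind (i + l) * z l) = (\<Sum>l=1..N'. pow2_ind (i + l) * x l)"
          using N' by (intro sum.cong) (auto simp: x_def)
        moreover have "(\<Sum>l=N'+1..K. pow2_ind (i + l) * z l) = (\<Sum>l=N'+1..K. pow2_ind (i + l) * x l)"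
          by (intro sum.cong) (auto simp: x_def)
        ultimately show ?thesis
          unfolding split by simp
      next
        case 3
        have "(\<Sum>j=1..N. pow2_ind (i + j) * x j) = x (2 * K - i)"
          using 3 N' K i by (subst single) auto
        also have "\<dots> = y i"
          using 3 N' K i by (auto simp: x_def z_def)
        finally show ?thesis .
      qed
    qed
    moreover have "(\<Sum>j=1..N. pow2_ind j * x j) \<ge> 0" if y: "\<forall>i\<in>{1..N}. y i = pow2_ind i"
    proof -
      have yB: "y (2 * K - j) = pow2_ind (2 * K - j)" if "j \<in> {N'+1..K}" for j
      proof -
        have "2 * K - j \<in> {1..N}"
          using that N' K by auto
        then show ?thesis
          using y by blast
      qed
      \<comment> \<open>The correction in \<open>y'\<close> vanishes: \<open>y (2 * K - j)\<close>
        can be nonzero only at \<open>j = K\<close>, and there \<open>K < i + j < 2 * K\<close>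
        makes the other factor zero.\<close>
      have "y' i = pow2_ind i" if i: "i \<in> {1..N'}" for i
      proof -
        have "pow2_ind (i + j) * y (2 * K - j) = 0" if j: "j \<in> {N'+1..K}" for j
        proof (cases "j = K")
          case True
          then show ?thesis
            using i N' ind[of "i + j"] by simp
        next
          case False
          have "K < 2 * K - j" "2 * K - j < 4 * K" "2 * K - j \<noteq> 2 * K"
            using j N' K False by auto
          then show ?thesis
            using yB[OF j] ind[of "2 * K - j"] by simp
        qed
        then have "(\<Sum>j=N'+1..K. pow2_ind (i + j) * y (2 * K - j)) = 0"
          by (intro sum.neutral) blast
        then show ?thesis
          using y i N' by (simp add: y'_def)
      qed
      then have "(\<Sum>j=1..N'. pow2_ind j * x j) \<ge> 0"
        unfolding xA by (intro q') simp
      moreover have "(\<Sum>j=N'+1..K. pow2_ind j * x j) \<ge> 0"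
        unfolding xB by (intro sum_nonneg) (simp add: yB pow2_ind_nonneg)
      moreover have "(\<Sum>j=K+1..N. pow2_ind j * x j) = 0"
        using K by (intro sum.neutral) (auto simp: ind)
      ultimately show ?thesis
        unfolding split by simp
    qed
    ultimately show ?thesis
      by blast
  qed
qed

text \<open>Solving for each unit vector gives an integer right inverse, so the determinant is a
  unit of the integers.\<close>

lemma det_pow2_hankel: "\<bar>det (mat N N (\<lambda>(i, j). - pow2_ind (i + j + 2)))\<bar> = 1"
proof -
  define M where "M = mat N N (\<lambda>(i, j). - pow2_ind (i + j + 2))"
  have "\<exists>x. \<forall>i<N. (\<Sum>j=0..<N. - pow2_ind (i + j + 2) * x j) = (if i = l then 1 else 0)" for l
  proof -
    \<comment> \<open>The value \<open>- 1\<close> absorbs the sign of the matrix, and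
      \<open>Suc l\<close> the passage to indices from 1.\<close>
    obtain x where x: "\<And>i. i \<in> {1..N} \<Longrightarrow>
        (\<Sum>j=1..N. pow2_ind (i + j) * x j) = (if i = Suc l then - 1 else 0)"
      using pow2_hankel_solvable[of N "\<lambda>i. if i = Suc l then - 1 else 0"] by blast
    have "(\<Sum>j=0..<N. - pow2_ind (i + j + 2) * x (Suc j)) = (if i = l then 1 else 0)" if "i < N" for i
    proof -
      have "(\<Sum>j=0..<N. - pow2_ind (i + j + 2) * x (Suc j)) =
          - (\<Sum>j=Suc 0..<Suc N. pow2_ind (Suc i + j) * x j)"
        by (simp add: sum.shift_bounds_Suc_ivl sum_negf del: sum.op_ivl_Suc)
      then show ?thesis
        using x[of "Suc i"] that by (auto simp: atLeastLessThanSuc_atLeastAtMost)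
    qed
    then show ?thesis
      by (intro exI[of _ "\<lambda>j. x (Suc j)"]) blast
  qed
  then obtain x where x: "\<And>l i. i < N \<Longrightarrow>
      (\<Sum>j=0..<N. - pow2_ind (i + j + 2) * x l j) = (if i = l then 1 else 0)"
    by metis
  define X where "X = mat N N (\<lambda>(j, l). x l j)"
  have "M * X = 1\<^sub>m N"
    by (rule eq_matI) (auto simp: M_def X_def scalar_prod_def x[simplified])
  then have "det M * det X = 1"
    using det_mult[of M N X] by (simp add: M_def X_def)
  then show ?thesis
    unfolding M_def using zmult_eq_1_iff by fastforce
qed

section \<open>Determinants by triangular elimination\<close>

lemma det_lower_unitriangular:
  fixes A :: "'a::comm_ring_1 mat"
  assumes A: "A \<in> carrier_mat n n"
    and "\<And>i j. i < j \<Longrightarrow> j < n \<Longrightarrow> A $$ (i, j) = 0"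
    and "\<And>i. i < n \<Longrightarrow> A $$ (i, i) = 1"
  shows "det A = 1"
  using assms by (subst det_lower_triangular[OF _ A]) (auto simp: prod_list_diag_prod)

lemma det_first_column_zero:
  fixes A :: "'a::idom mat"
  assumes A: "A \<in> carrier_mat (Suc N) (Suc N)"
    and zero: "\<And>i. i < N \<Longrightarrow> A $$ (Suc i, 0) = 0"
  shows "det A = A $$ (0, 0) * det (mat N N (\<lambda>(i, j). A $$ (Suc i, Suc j)))"
proof -
  have "A = four_block_mat (mat 1 1 (\<lambda>_. A $$ (0, 0))) (mat 1 N (\<lambda>(i, j). A $$ (0, Suc j)))
              (0\<^sub>m N 1) (mat N N (\<lambda>(i, j). A $$ (Suc i, Suc j)))"
    using A zero by (intro eq_matI) (auto simp: less_Suc_eq_0_disj)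
  then have "det A = det (mat 1 1 (\<lambda>_. A $$ (0, 0))) * det (mat N N (\<lambda>(i, j). A $$ (Suc i, Suc j)))"
    by (metis det_four_block_mat_lower_left_zero mat_carrier)
  then show ?thesis
    by (simp add: det_single)
qed

lemma det_eliminate_first_column:
  fixes A :: "'a::idom mat"
  assumes A: "A \<in> carrier_mat (Suc N) (Suc N)"
    and zero: "\<And>i. i < N \<Longrightarrow> A $$ (Suc i, 0) + (\<Sum>k=1..N. A $$ (Suc i, k) * c k) = 0"
  shows "det A = (A $$ (0, 0) + (\<Sum>k=1..N. A $$ (0, k) * c k)) *
                 det (mat N N (\<lambda>(i, j). A $$ (Suc i, Suc j)))"
proof -
  define U where "U = mat (Suc N) (Suc N)
    (\<lambda>(i, j). if i = j then 1 else if j = 0 then c i else 0)"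
  have U: "U \<in> carrier_mat (Suc N) (Suc N)"
    by (simp add: U_def)
  have "det U = 1"
    by (rule det_lower_unitriangular[OF U]) (auto simp: U_def)
  then have "det A = det (A * U)"
    using det_mult[OF A U] by simp
  moreover have col0: "(A * U) $$ (i, 0) = A $$ (i, 0) + (\<Sum>k=1..N. A $$ (i, k) * c k)" if "i < Suc N" for i
  proof -
    have "(A * U) $$ (i, 0) = (\<Sum>k=0..<Suc N. A $$ (i, k) * (if k = 0 then 1 else c k))"
      using that A by (auto simp: U_def scalar_prod_def intro!: sum.cong)
    also have "\<dots> = A $$ (i, 0) + (\<Sum>k=1..N. A $$ (i, k) * c k)"
      by (simp add: atLeastLessThanSuc_atLeastAtMost sum.atLeast_Suc_atMost del: sum.op_ivl_Suc)
    finally show ?thesis .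
  qed
  moreover have "(A * U) $$ (i, Suc j) = A $$ (i, Suc j)" if "i < Suc N" "j < N" for i j
  proof -
    have "(A * U) $$ (i, Suc j) = (\<Sum>k=0..<Suc N. A $$ (i, k) * U $$ (k, Suc j))"
      using that A U by (simp add: scalar_prod_def del: sum.op_ivl_Suc)
    also have "\<dots> = (\<Sum>k=0..<Suc N. if k = Suc j then A $$ (i, k) else 0)"
      using that by (intro sum.cong) (auto simp: U_def)
    finally show ?thesis
      using that by (simp del: sum.op_ivl_Suc)
  qed
  then have "mat N N (\<lambda>(i, j). (A * U) $$ (Suc i, Suc j)) = mat N N (\<lambda>(i, j). A $$ (Suc i, Suc j))"
    by (intro eq_matI) auto
  ultimately show ?thesis
    using det_first_column_zero[of "A * U" N] A U zero by auto
qed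

text \<open>With \<open>H\<close> the Hankel matrix of \<open>F\<close> and \<open>T\<close> the lower triangular Toeplitz matrix of \<open>A\<close>,
  the entries of \<open>T H T\<^sup>t\<close> have the generating function
  \<open>(x (F A)(x) A(y) - y (F A)(y) A(x)) / (x - y)\<close>; the recursion for \<open>E\<close> expresses this.\<close>

lemma hankel_det_toeplitz_congruence:
  fixes F A :: "'a::comm_ring_1 fps"
  assumes A0: "fps_nth A 0 = 1"
    and E0: "\<And>i. E i 0 = fps_nth (F * A) i"
    and ESuc: "\<And>i j. E i (Suc j) = E (Suc i) j + fps_nth (F * A) i * fps_nth A (Suc j)
                 - fps_nth (F * A) j * fps_nth A (Suc i)"
  shows "hankel_det n F = det (mat n n (\<lambda>(i, j). E i j))"
proof -
  define a where "a = fps_nth A"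
  define f where "f = fps_nth F"
  \<comment> \<open>These are the entries of \<open>H * T\<^sup>T\<close> below, defined for all
    indices because the induction on \<open>j\<close> passes from row \<open>i\<close> to row
    \<open>Suc i\<close>, possibly beyond \<open>n\<close>.\<close>
  define L where "L k j = (\<Sum>l\<le>j. f (k + l) * a (j - l))" for k j
  have FA: "fps_nth (F * A) i = (\<Sum>l\<le>i. f l * a (i - l))" for i
    by (simp add: fps_mult_nth f_def a_def atLeast0AtMost)
  have L_Suc: "L k (Suc j) = L (Suc k) j + f k * a (Suc j)" for k j
    by (simp add: L_def sum.atMost_Suc_shift del: sum.atMost_Suc)
  have E: "E i j = (\<Sum>k\<le>i. a (i - k) * L k j)" for i j
  proof (induction j arbitrary: i)
    case 0
    show ?case
      using A0 by (simp only: E0 FA) (simp add: L_def a_def mult.commute)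
  next
    case (Suc j)
    have "(\<Sum>k\<le>i. a (i - k) * L k (Suc j)) =
        (\<Sum>k\<le>i. a (i - k) * L (Suc k) j) + fps_nth (F * A) i * a (Suc j)"
      unfolding L_Suc FA by (simp add: algebra_simps sum.distrib sum_distrib_left)
    moreover have "(\<Sum>k\<le>Suc i. a (Suc i - k) * L k j) =
        (\<Sum>k\<le>i. a (i - k) * L (Suc k) j) + a (Suc i) * fps_nth (F * A) j"
      by (simp add: sum.atMost_Suc_shift FA L_def del: sum.atMost_Suc)
    ultimately show ?case
      by (simp add: ESuc Suc.IH a_def del: sum.atMost_Suc)
  qed
  define T where "T = mat n n (\<lambda>(i, k). if k \<le> i then a (i - k) else 0)"
  define H where "H = mat n n (\<lambda>(i, j). f (i + j))"
  have T: "T \<in> carrier_mat n n" and H: "H \<in> carrier_mat n n"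
    by (simp_all add: T_def H_def)
  have "det T = 1"
    by (rule det_lower_unitriangular[OF T]) (auto simp: T_def a_def A0)
  have HT: "(H * T\<^sup>T) $$ (k, j) = L k j" if "k < n" "j < n" for k j
  proof -
    have "(H * T\<^sup>T) $$ (k, j) = (\<Sum>l=0..<n. if l \<le> j then f (k + l) * a (j - l) else 0)"
      using that by (auto simp: H_def T_def scalar_prod_def intro!: sum.cong)
    also have "\<dots> = L k j"
      unfolding L_def using that by (intro sum.mono_neutral_cong_right) auto
    finally show ?thesis .
  qed
  have "(T * (H * T\<^sup>T)) $$ (i, j) = E i j" if "i < n" "j < n" for i j
  proof -
    have "(T * (H * T\<^sup>T)) $$ (i, j) = (\<Sum>k=0..<n. T $$ (i, k) * (H * T\<^sup>T) $$ (k, j))"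
      using that T H by (simp add: scalar_prod_def)
    also have "\<dots> = (\<Sum>k=0..<n. if k \<le> i then a (i - k) * L k j else 0)"
      using that by (intro sum.cong refl, subst HT) (auto simp: T_def)
    also have "\<dots> = E i j"
      unfolding E using that by (intro sum.mono_neutral_cong_right) auto
    finally show ?thesis .
  qed
  then have "T * (H * T\<^sup>T) = mat n n (\<lambda>(i, j). E i j)"
    using T H by (intro eq_matI) auto
  moreover have "det (T * (H * T\<^sup>T)) = det H"
    using \<open>det T = 1\<close> T H by (simp add: det_mult[of _ n] det_transpose)
  ultimately show ?thesis
    by (simp add: hankel_det_def H_def f_def)
qed

section \<open>The two Hankel determinants of the theorem\<close>

lemma r_series_nth: "fps_nth r_series m = of_int (pow2_ind (Suc m))"
proof -
  have "m = 2 ^ k - 1 \<longleftrightarrow> Suc m = 2 ^ k" for k :: nat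
    by (metis Suc_diff_1 diff_Suc_1 zero_less_numeral zero_less_power)
  then show ?thesis
    by (simp add: r_series_def pow2_ind_def)
qed

lemma r_series_nth_0: "fps_nth r_series 0 = 1"
  by (auto simp: r_series_nth pow2_ind_def intro!: exI[of _ 0])

lemma r_series_nth_1: "fps_nth r_series (Suc 0) = 1"
  by (auto simp: r_series_nth pow2_ind_def intro!: exI[of _ 1])

lemma hankel_det_r_series_quotient:
  "hankel_det (Suc N) (r_series / (r_series - fps_X)) =
     of_int (det (mat N N (\<lambda>(i, j). - pow2_ind (i + j + 2))))"
proof -
  define A where "A = r_series - fps_X"
  define r where "r = fps_nth r_series"
  have A0: "fps_nth A 0 = 1"
    by (simp add: A_def r_series_nth_0)
  have r0: "r 0 = 1" "r (Suc 0) = 1"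
    by (simp_all add: r_def r_series_nth_0 r_series_nth_1)
  have FA: "r_series / A * A = r_series"
    using A0 by (intro dvd_div_mult_self) (simp add: fps_is_unit_iff unit_imp_dvd)
  have A: "fps_nth A (Suc j) = r (Suc j) - (if j = 0 then 1 else 0)" for j
    by (simp add: A_def r_def fps_X_nth)
  \<comment> \<open>Coefficients of \<open>r(x) r(y) - x y (r(x) - r(y)) / (x - y)\<close>, which is
    the generating function above for \<open>F A = r\<close> and \<open>A = r - x\<close>.\<close>
  define E where "E i j = r i * r j - (if i = 0 \<or> j = 0 then 0 else r (i + j - 1))" for i j
  have "hankel_det (Suc N) (r_series / A) = det (mat (Suc N) (Suc N) (\<lambda>(i, j). E i j))"
    by (rule hankel_det_toeplitz_congruence[of A])
       (auto simp: A0 FA A E_def r0 r_def[symmetric] algebra_simps)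
  also have "\<dots> = det (mat N N (\<lambda>(i, j). - of_int (pow2_ind (i + j + 2))))"
  proof -
    \<comment> \<open>As \<open>r 0 = 1\<close>, row 0 of \<open>E\<close> is \<open>r\<close>;
      subtracting \<open>r i\<close> times it from row \<open>i\<close> removes the rank-one part
      and leaves \<open>D\<close>. The matrix \<open>L\<close> reverses this.\<close>
    define L where "L = mat (Suc N) (Suc N) (\<lambda>(i, j). if i = j then 1 else if j = 0 then r i else 0)"
    define D where "D = mat (Suc N) (Suc N)
      (\<lambda>(i, j). if i = 0 then r j else if j = 0 then 0 else - r (i + j - 1))"
    have L: "L \<in> carrier_mat (Suc N) (Suc N)" and D: "D \<in> carrier_mat (Suc N) (Suc N)"
      by (simp_all add: L_def D_def)
    have "(L * D) $$ (i, j) = E i j" if "i < Suc N" "j < Suc N" for i j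
    proof -
      have "(L * D) $$ (i, j) = (\<Sum>k=0..<Suc N. L $$ (i, k) * D $$ (k, j))"
        using that L D by (simp add: scalar_prod_def del: sum.op_ivl_Suc)
      also have "\<dots> = L $$ (i, 0) * D $$ (0, j) + (\<Sum>k=Suc 0..<Suc N. L $$ (i, k) * D $$ (k, j))"
        by (simp add: sum.atLeast_Suc_lessThan del: sum.op_ivl_Suc)
      also have "(\<Sum>k=Suc 0..<Suc N. L $$ (i, k) * D $$ (k, j)) =
          (\<Sum>k=Suc 0..<Suc N. if k = i then D $$ (i, j) else 0)"
        using that by (intro sum.cong) (auto simp: L_def)
      also have "L $$ (i, 0) * D $$ (0, j) + \<dots> = E i j"
        using that by (cases "i = 0") (auto simp: L_def D_def E_def r0 simp del: sum.op_ivl_Suc)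
      finally show ?thesis .
    qed
    then have "mat (Suc N) (Suc N) (\<lambda>(i, j). E i j) = L * D"
      using L D by (intro eq_matI) auto
    moreover have "det L = 1"
      by (rule det_lower_unitriangular[OF L]) (auto simp: L_def)
    moreover have "det D = det (mat N N (\<lambda>(i, j). - of_int (pow2_ind (i + j + 2))))"
    proof -
      have "det D = D $$ (0, 0) * det (mat N N (\<lambda>(i, j). D $$ (Suc i, Suc j)))"
        by (rule det_first_column_zero[OF D]) (simp add: D_def)
      also have "mat N N (\<lambda>(i, j). D $$ (Suc i, Suc j)) = mat N N (\<lambda>(i, j). - of_int (pow2_ind (i + j + 2)))"
        by (rule eq_matI) (auto simp: D_def r_def r_series_nth)
      finally show ?thesis
        by (simp add: D_def r0)
    qed
    ultimately show ?thesis
      using det_mult[OF L D] by simp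
  qed
  also have "mat N N (\<lambda>(i, j). - of_int (pow2_ind (i + j + 2)) :: rat) =
      map_mat of_int (mat N N (\<lambda>(i, j). - pow2_ind (i + j + 2)))"
    by (rule eq_matI) auto
  finally show ?thesis
    by (simp add: A_def)
qed

text \<open>Adding \<open>- x k\<close> times column \<open>k\<close> to column 0 clears it below
  the top entry, which becomes \<open>1 + q\<close>.\<close>

lemma hankel_det_one_minus_X_r_series:
  "\<exists>q\<ge>0. hankel_det (Suc N) (1 - fps_X * r_series) =
     (1 + q) * of_int (det (mat N N (\<lambda>(i, j). - pow2_ind (i + j + 2))))"
proof -
  obtain x where x: "\<And>i. i \<in> {1..N} \<Longrightarrow> (\<Sum>j=1..N. pow2_ind (i + j) * x j) = pow2_ind i"
    and q: "(\<Sum>j=1..N. pow2_ind j * x j) \<ge> 0"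
    using pow2_hankel_solvable[of N pow2_ind] by blast
  define A where "A = mat (Suc N) (Suc N) (\<lambda>(i, j). if i + j = 0 then 1 else - pow2_ind (i + j))"
  have "hankel_det (Suc N) (1 - fps_X * r_series) = det (map_mat (of_int :: int \<Rightarrow> rat) A)"
    unfolding hankel_det_def
    by (intro arg_cong[of _ _ det] eq_matI) (auto simp: A_def r_series_nth)
  also have "\<dots> = of_int (det A)"
    by simp
  also have "det A = (A $$ (0, 0) + (\<Sum>k=1..N. A $$ (0, k) * - x k)) *
                 det (mat N N (\<lambda>(i, j). A $$ (Suc i, Suc j)))"
  proof (rule det_eliminate_first_column)
    fix i assume i: "i < N"
    have "(\<Sum>k=1..N. A $$ (Suc i, k) * - x k) = (\<Sum>k=1..N. pow2_ind (Suc i + k) * x k)"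
      using i by (intro sum.cong) (auto simp: A_def)
    then show "A $$ (Suc i, 0) + (\<Sum>k=1..N. A $$ (Suc i, k) * - x k) = 0"
      using i x[of "Suc i"] by (simp add: A_def)
  qed (simp add: A_def)
  also have "(\<Sum>k=1..N. A $$ (0, k) * - x k) = (\<Sum>k=1..N. pow2_ind k * x k)"
    by (intro sum.cong) (auto simp: A_def)
  also have "mat N N (\<lambda>(i, j). A $$ (Suc i, Suc j)) = mat N N (\<lambda>(i, j). - pow2_ind (i + j + 2))"
    by (rule eq_matI) (auto simp: A_def)
  finally show ?thesis
    using q by (intro exI[of _ "of_int (\<Sum>k=1..N. pow2_ind k * x k)"])
      (simp add: A_def del: of_int_sum)
qed

theorem theorem37:
  fixes n :: nat
  shows "hankel_det n (r_series / (r_series - fps_X))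
           = sign_nonneg (hankel_det n (1 - fps_X * r_series))"
proof (cases n)
  case 0
  then show ?thesis
    by (simp add: hankel_det_0 sign_nonneg_def)
next
  case (Suc N)
  define d where "d = det (mat N N (\<lambda>(i, j). - pow2_ind (i + j + 2)))"
  have "d = 1 \<or> d = - 1"
    using det_pow2_hankel[of N] unfolding d_def by linarith
  moreover obtain q :: rat where "q \<ge> 0"
    "hankel_det (Suc N) (1 - fps_X * r_series) = (1 + q) * of_int d"
    using hankel_det_one_minus_X_r_series[of N] unfolding d_def by blast
  \<comment> \<open>Since \<open>1 + q > 0\<close>, the sign is that of \<open>d\<close>, and
    \<open>d\<close> equals its own sign.\<close>
  ultimately show ?thesis
    unfolding Suc hankel_det_r_series_quotient d_def[symmetric] by (auto simp: sign_nonneg_def)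
qed

end
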